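(* Let $N, W, L, M$ be positive integers and let $\mathbf{w}=(w[0],\dots,w[W-1])^T\in\mathbb{C}^W$ be a window such that (i) $\mathbf{w}$ is non-vanishing, i.e. $w[n]\neq 0$ for all $0\le n\le W-1$; (ii) $L<W\le \frac{N}{2}$; (iii) $2W\le M\le N$. Then for almost all non-vanishing signals $\mathbf{x}\in\mathbb{C}^N$ (i.e. all $\mathbf{x}$ with $x[n]\neq0$ for every $n$, except those in a subset of Lebesgue measure zero), the following holds: if $\mathbf{y}\in\mathbb{C}^N$ satisfies $Z_w^{\mathbf{y}}[m,r]=Z_w^{\mathbf{x}}[m,r]$ for all $1\le m\le M$ and $0\le r\le R-1$, then $\mathbf{y}=e^{i\phi}\mathbf{x}$ for some real $\phi$. That is, $\mathbf{x}$ is uniquely determined, up to a global phase, by its STFT magnitude measurements.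
   Context: Signals $\mathbf{x}=(x[0],\dots,x[N-1])^T\in\mathbb{C}^N$; the window is extended by $w[k]=0$ for $k\notin\{0,\dots,W-1\}$. The STFT of $\mathbf{x}$ with respect to $\mathbf{w}$ with shift $L$ is $Y_w^{\mathbf{x}}[m,r]=\sum_{n=0}^{N-1}x[n]\,w[rL-n]\,e^{-i2\pi mn/N}$ for integers $m$ (indices taken modulo $N$) and $0\le r\le R-1$, where $R=\lceil (N+W-1)/L\rceil$ is the number of short-time sections. The STFT magnitude measurements are $Z_w^{\mathbf{x}}[m,r]=|Y_w^{\mathbf{x}}[m,r]|^2$. *)

theory Defs
  imports "HOL-Analysis.Analysis" "HOL-Probability.Probability"
begin

definition win_ext :: "(nat \<Rightarrow> complex) \<Rightarrow> nat \<Rightarrow> int \<Rightarrow> complex" where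
  "win_ext w W k = (if 0 \<le> k \<and> k < int W then w (nat k) else 0)"

definition stft :: "nat \<Rightarrow> (nat \<Rightarrow> complex) \<Rightarrow> nat \<Rightarrow> nat \<Rightarrow> (nat \<Rightarrow> complex) \<Rightarrow> int \<Rightarrow> nat \<Rightarrow> complex" where
  "stft N w W L x m r =
     (\<Sum>n<N. x n * win_ext w W (int r * int L - int n)
              * exp (- (\<i> * 2 * pi * of_int m * of_nat n / of_nat N)))"

definition stft_mag :: "nat \<Rightarrow> (nat \<Rightarrow> complex) \<Rightarrow> nat \<Rightarrow> nat \<Rightarrow> (nat \<Rightarrow> complex) \<Rightarrow> int \<Rightarrow> nat \<Rightarrow> real" where
  "stft_mag N w W L x m r = (cmod (stft N w W L x m r))\<^sup>2"

definition num_sections :: "nat \<Rightarrow> nat \<Rightarrow> nat \<Rightarrow> nat" where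
  "num_sections N W L = nat \<lceil>real (N + W - 1) / real L\<rceil>"

definition signal_space :: "nat \<Rightarrow> (nat \<Rightarrow> complex) measure" where
  "signal_space N = PiM {..<N} (\<lambda>_. lborel)"

end

theory Submission
  imports Defs "HOL-Computational_Algebra.Fundamental_Theorem_Algebra"
    "HOL-Computational_Algebra.Field_as_Ring" "HOL-Computational_Algebra.Polynomial_Factorial"
begin

text \<open>
  A short-time section is a polynomial \<open>p\<close> of degree less than \<open>W\<close>, and its measurements determine
  \<open>p * conj_reflect p\<close>. If \<open>q\<close> has the same measurements and the same modulus at its first entry,
  then \<open>q = u * v\<close> with \<open>u\<close> dividing \<open>p\<close> and \<open>v\<close> dividing \<open>conj_reflect p\<close>; comparing the moduli
  of the products of the roots gives, unless \<open>q\<close> is a multiple of \<open>p\<close>, a relation between divisors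
  of \<open>p\<close> that a dilation \<open>p(z) \<mapsto> p(t z)\<close> destroys for all but finitely many \<open>t > 0\<close>.
  Outside this exceptional situation the sections are determined up to phase one after another,
  starting from the single sample seen by section \<open>0\<close>, because consecutive sections overlap.
  So every ray \<open>t \<mapsto> (t ^ n * x n)\<^sub>n\<close> contains finitely many ambiguous signals, and by Fubini
  the ambiguous signals form a null set.
\<close>

subsection \<open>Polynomials with the same spectrum on the unit circle\<close>

text \<open>By Vieta, this is the modulus of the product of the roots.\<close>
definition root_modulus :: "complex poly \<Rightarrow> real" where
  "root_modulus p = cmod (coeff p 0) / cmod (lead_coeff p)"

lemma root_modulus_mult: "root_modulus (p * q) = root_modulus p * root_modulus q"
  by (simp add: root_modulus_def coeff_mult_0 lead_coeff_mult norm_mult)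

lemma root_modulus_degree_0: "degree p = 0 \<Longrightarrow> p \<noteq> 0 \<Longrightarrow> root_modulus p = 1"
  using leading_coeff_0_iff[of p] by (simp add: root_modulus_def)

text \<open>In a factorization of a linear polynomial one factor is constant and has
  \<open>root_modulus\<close> 1, so by multiplicativity the other carries the whole value.\<close>

lemma root_modulus_linear_factor:
  assumes "f dvd [:-a, 1:]"
  shows "root_modulus f \<in> {1, cmod a}"
proof -
  from assms obtain g where g: "[:-a, 1:] = f * g" by (elim dvdE)
  have nz: "f \<noteq> 0" "g \<noteq> 0" using g by auto
  have "degree f + degree g = 1" using g nz by (metis degree_mult_eq degree_pCons_eq_if one_neq_zero pCons_eq_0_iff degree_0 One_nat_def)
  moreover have "root_modulus f * root_modulus g = cmod a"
    unfolding root_modulus_mult[symmetric] g[symmetric] by (simp add: root_modulus_def)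
  ultimately show ?thesis using nz root_modulus_degree_0 by (cases "degree f = 0") auto
qed

text \<open>The value at a divisor is the product of the moduli of some of the roots of
  \<open>p\<close>. The induction splits off one root \<open>a\<close>, which contributes a factor
  \<open>1\<close> or \<open>cmod a\<close>.\<close>

lemma finite_root_modulus_divisors:
  assumes "p \<noteq> 0"
  shows "finite (root_modulus ` {f. f dvd p})"
  using assms
proof (induction "degree p" arbitrary: p)
  case 0
  have "root_modulus f = 1" if "f dvd p" for f
    using 0 that dvd_imp_degree_le[OF that] by (intro root_modulus_degree_0) auto
  then have "root_modulus ` {f. f dvd p} \<subseteq> {1}" by auto
  then show ?case using finite_subset by blast
next
  case (Suc n)
  then have "\<not> constant (poly p)" by (simp add: constant_degree)
  then obtain a where "poly p a = 0" using fundamental_theorem_of_algebra by blast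
  then obtain q where p: "p = [:-a, 1:] * q" using poly_eq_0_iff_dvd by (metis dvdE)
  have q: "q \<noteq> 0" using Suc.prems p by auto
  have "degree p = Suc (degree q)" unfolding p using q by (subst degree_mult_eq) auto
  then have IH: "finite (root_modulus ` {f. f dvd q})" using Suc.hyps q by simp
  have "root_modulus ` {f. f dvd p} \<subseteq>
      (\<lambda>(s, t). s * t) ` ({1, cmod a} \<times> (root_modulus ` {f. f dvd q}))"
  proof
    fix s assume "s \<in> root_modulus ` {f. f dvd p}"
    then obtain f where f: "f dvd p" "s = root_modulus f" by auto
    then obtain g h where "f = g * h" "g dvd [:-a, 1:]" "h dvd q"
      using division_decomp[of f "[:-a, 1:]" q] p by auto
    then show "s \<in> (\<lambda>(s, t). s * t) ` ({1, cmod a} \<times> (root_modulus ` {f. f dvd q}))"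
      using root_modulus_linear_factor[of g a] f by (force simp: root_modulus_mult)
  qed
  then show ?case using IH by (meson finite_SigmaI finite_imageI finite_subset finite.intros)
qed

text \<open>The roots of this polynomial are the reflections of the roots of \<open>p\<close> in the unit circle.\<close>
definition conj_reflect :: "complex poly \<Rightarrow> complex poly" where
  "conj_reflect p = reflect_poly (map_poly cnj p)"

lemma degree_map_poly_cnj [simp]: "degree (map_poly cnj p) = degree p"
  by (rule degree_map_poly) auto

lemma coeff_map_poly_cnj [simp]: "coeff (map_poly cnj p) i = cnj (coeff p i)"
  by (simp add: coeff_map_poly)

lemma map_poly_cnj_mult: "map_poly cnj (p * q) = map_poly cnj p * map_poly cnj q"
  by (rule poly_eqI) (simp add: coeff_mult)

lemma conj_reflect_mult: "conj_reflect (p * q) = conj_reflect p * conj_reflect q"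
  by (simp add: conj_reflect_def map_poly_cnj_mult reflect_poly_mult)

lemma coeff_0_conj_reflect: "coeff (conj_reflect p) 0 = cnj (lead_coeff p)"
  by (simp add: conj_reflect_def)

lemma degree_conj_reflect: "coeff p 0 \<noteq> 0 \<Longrightarrow> degree (conj_reflect p) = degree p"
  by (simp add: conj_reflect_def)

lemma lead_coeff_conj_reflect:
  "coeff p 0 \<noteq> 0 \<Longrightarrow> lead_coeff (conj_reflect p) = cnj (coeff p 0)"
  by (simp add: conj_reflect_def coeff_reflect_poly)

text \<open>Reversing the coefficients loses low-order zeros; a nonzero constant coefficient rules
  this out.\<close>

lemma conj_reflect_conj_reflect:
  assumes "coeff p 0 \<noteq> 0" shows "conj_reflect (conj_reflect p) = p"
proof (rule poly_eqI)
  fix i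
  have d: "degree (reflect_poly (map_poly cnj p)) = degree p" using assms by simp
  show "coeff (conj_reflect (conj_reflect p)) i = coeff p i"
    unfolding conj_reflect_def using assms d by (simp add: coeff_reflect_poly coeff_eq_0)
qed

text \<open>On the unit circle \<open>inverse z = cnj z\<close>. Hence
  \<open>p * conj_reflect p\<close> encodes the squared modulus of \<open>p\<close> there, up to the
  factor \<open>z ^ degree p\<close>.\<close>

lemma poly_conj_reflect:
  assumes "cmod z = 1"
  shows "poly (conj_reflect p) z = z ^ degree p * cnj (poly p z)"
proof -
  have z: "z \<noteq> 0" using assms by auto
  have "inverse z = cnj z" using assms by (simp add: inverse_complex_def complex_norm_square complex_eq_iff cmod_def)
  then show ?thesis using z by (simp add: conj_reflect_def poly_reflect_poly_nz)
qed

lemma root_modulus_conj_reflect: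
  "coeff p 0 \<noteq> 0 \<Longrightarrow> root_modulus (conj_reflect p) = 1 / root_modulus p"
  unfolding root_modulus_def lead_coeff_conj_reflect coeff_0_conj_reflect
  by simp

text \<open>Since \<open>q\<close> divides \<open>p * conj_reflect p\<close>, it splits into a
  divisor of \<open>p\<close> and a divisor of \<open>conj_reflect p\<close>. Reflecting the second
  one gives a divisor of \<open>p\<close> with inverse \<open>root_modulus\<close>, and
  \<open>q\<close> and \<open>p\<close> have equal \<open>root_modulus\<close>.\<close>

lemma spectral_factor_ambiguity:
  fixes p q :: "complex poly"
  assumes p0: "coeff p 0 \<noteq> 0"
    and eq: "q * conj_reflect q = p * conj_reflect p"
    and deg: "degree q = degree p"
    and q0: "cmod (coeff q 0) = cmod (coeff p 0)"
  shows "(\<exists>c. q = smult c p) \<or>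
    (\<exists>u v. u dvd p \<and> v dvd p \<and> degree u + degree v = degree p \<and> degree v > 0 \<and>
       root_modulus p * root_modulus v = root_modulus u)"
proof -
  have pn: "p \<noteq> 0" and qn0: "coeff q 0 \<noteq> 0" using p0 q0 by auto
  \<comment> \<open>The constant coefficient of the spectrum ties the first coefficient to the
    leading one, so equal first moduli force equal leading moduli.\<close>
  have "coeff (q * conj_reflect q) 0 = coeff (p * conj_reflect p) 0" using eq by simp
  then have "coeff q 0 * cnj (lead_coeff q) = coeff p 0 * cnj (lead_coeff p)"
    by (simp add: coeff_mult_0 coeff_0_conj_reflect)
  then have "cmod (coeff q 0) * cmod (lead_coeff q) = cmod (coeff p 0) * cmod (lead_coeff p)"
    by (metis complex_mod_cnj norm_mult)
  then have "cmod (lead_coeff q) = cmod (lead_coeff p)" using p0 q0 by simp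
  then have rq: "root_modulus q = root_modulus p" using q0 by (simp add: root_modulus_def)
  have "q dvd p * conj_reflect p" using eq by (metis dvd_triv_left)
  then obtain u v where uv: "q = u * v" "u dvd p" "v dvd conj_reflect p"
    using division_decomp by metis
  have v0: "coeff v 0 \<noteq> 0" using qn0 uv(1) by (auto simp: coeff_mult_0)
  have nz: "u \<noteq> 0" "v \<noteq> 0" using qn0 uv(1) by auto
  have d: "degree u + degree v = degree p" using deg uv(1) nz by (simp add: degree_mult_eq)
  show ?thesis
  proof (cases "degree v = 0")
    case True
    then obtain b where b: "v = [:b:]" by (meson degree_eq_zeroE)
    \<comment> \<open>With \<open>v\<close> constant, \<open>u\<close> has the full degree of
      \<open>p\<close>, so its cofactor is constant too.\<close>
    from uv(2) obtain g where g: "p = u * g" by (elim dvdE)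
    have "g \<noteq> 0" using g pn by auto
    then have "degree g = 0" using g d True nz by (simp add: degree_mult_eq)
    then obtain c where c: "g = [:c:]" by (meson degree_eq_zeroE)
    have "c \<noteq> 0" using c \<open>g \<noteq> 0\<close> by auto
    then have "q = smult (b / c) p" using uv(1) b c g by simp
    then show ?thesis by blast
  next
    case False
    let ?v = "conj_reflect v"
    from uv(3) have "?v dvd p"
      by (metis conj_reflect_conj_reflect conj_reflect_mult dvd_def p0)
    moreover have "degree ?v = degree v" using v0 by (rule degree_conj_reflect)
    moreover have "root_modulus p * root_modulus ?v = root_modulus u"
      using rq uv(1) v0 nz root_modulus_conj_reflect[OF v0]
      by (simp add: root_modulus_mult flip: rq) (simp add: root_modulus_def)
    ultimately show ?thesis using uv(2) d False by (intro disjI2 exI[of _ u] exI[of _ ?v]) auto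
  qed
qed

section \<open>Dilations and phase retrievability\<close>

definition dilate :: "real \<Rightarrow> complex poly \<Rightarrow> complex poly" where
  "dilate t p = pcompose p [:0, of_real t:]"

lemma coeff_dilate: "coeff (dilate t p) i = of_real (t ^ i) * coeff p i"
  using coeff_pcompose_monom_linear[of p "of_real t" i] by (simp add: dilate_def monom_altdef)

lemma degree_dilate: "t \<noteq> 0 \<Longrightarrow> degree (dilate t p) = degree p"
  by (simp add: dilate_def degree_pcompose)

lemma dilate_dvd: "f dvd p \<Longrightarrow> dilate t f dvd dilate t p"
  by (auto simp: dilate_def pcompose_mult elim!: dvdE)

lemma dilate_inverse: "t \<noteq> 0 \<Longrightarrow> dilate (1 / t) (dilate t p) = p"
  by (rule poly_eqI) (simp add: coeff_dilate power_divide)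

text \<open>Each of the \<open>degree p\<close> roots is divided by \<open>t\<close>.\<close>

lemma root_modulus_dilate:
  "t > 0 \<Longrightarrow> root_modulus (dilate t p) = root_modulus p / t ^ degree p"
  by (simp add: root_modulus_def coeff_dilate degree_dilate norm_mult norm_power)

text \<open>The condition on the constant coefficients stands for a sample of known modulus,
  supplied by the overlap with the previous section. It is there to exclude rivals such as
  \<open>conj_reflect p\<close>.\<close>

definition phase_retrievable :: "complex poly \<Rightarrow> bool" where
  "phase_retrievable p \<longleftrightarrow> (\<forall>q. q * conj_reflect q = p * conj_reflect p \<longrightarrow> degree q = degree p \<longrightarrow>
     cmod (coeff q 0) = cmod (coeff p 0) \<longrightarrow> (\<exists>c. q = smult c p))"

lemma conj_reflect_smult: "conj_reflect (smult c p) = smult (cnj c) (conj_reflect p)"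
proof -
  have "map_poly cnj (smult c p) = smult (cnj c) (map_poly cnj p)" by (rule poly_eqI) simp
  then show ?thesis by (simp add: conj_reflect_def reflect_poly_smult)
qed

lemma phase_retrievable_smult:
  assumes p: "phase_retrievable p" and c: "c \<noteq> 0"
  shows "phase_retrievable (smult c p)"
  unfolding phase_retrievable_def
proof (intro allI impI)
  fix q assume q: "q * conj_reflect q = smult c p * conj_reflect (smult c p)"
    "degree q = degree (smult c p)" "cmod (coeff q 0) = cmod (coeff (smult c p) 0)"
  let ?q = "smult (inverse c) q"
  have "inverse (cnj c) * (inverse c * (cnj c * c)) = 1" using c by (simp add: field_simps)
  then have "?q * conj_reflect ?q = p * conj_reflect p"
    using q(1) by (simp add: conj_reflect_smult)
  moreover have "degree ?q = degree p" "cmod (coeff ?q 0) = cmod (coeff p 0)"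
    using q(2,3) c by (simp_all add: norm_mult norm_inverse)
  ultimately obtain b where "?q = smult b p" using p unfolding phase_retrievable_def by blast
  then have "smult c ?q = smult c (smult b p)" by simp
  then have "q = smult b (smult c p)" using c by (simp add: mult.commute)
  then show "\<exists>b. q = smult b (smult c p)" by blast
qed

text \<open>An ambiguity at \<open>t\<close> pulls back to divisors of the fixed \<open>p\<close>.
  The two sides of the relation scale with different powers of \<open>t\<close>, so \<open>t\<close>
  is determined by a degree and two values from a finite set.\<close>

lemma finite_bad_dilations:
  fixes p :: "complex poly"
  assumes p0: "coeff p 0 \<noteq> 0"
  shows "finite {t. t > 0 \<and> \<not> phase_retrievable (dilate t p)}" (is "finite ?B")
proof -
  define S where "S = root_modulus ` {f. f dvd p}"
  have fS: "finite S" unfolding S_def using p0 by (intro finite_root_modulus_divisors) auto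
  define T where "T = (\<lambda>(k, a, b). root (2 * k) (root_modulus p * b / a)) ` ({1..degree p} \<times> S \<times> S)"
  have "t \<in> T" if t: "t \<in> ?B" for t
  proof -
    have tp: "t > 0" using t by auto
    have pt0: "coeff (dilate t p) 0 = coeff p 0" by (simp add: coeff_dilate)
    obtain q where q: "q * conj_reflect q = dilate t p * conj_reflect (dilate t p)"
      "degree q = degree p" "cmod (coeff q 0) = cmod (coeff p 0)"
      "\<not> (\<exists>c. q = smult c (dilate t p))"
      using t pt0 degree_dilate[of t p] by (auto simp: phase_retrievable_def)
    obtain u v where uv: "u dvd dilate t p" "v dvd dilate t p" "degree u + degree v = degree p"
      "degree v > 0" "root_modulus (dilate t p) * root_modulus v = root_modulus u"
      using spectral_factor_ambiguity[of "dilate t p" q] q p0 pt0 tp degree_dilate[of t p] by auto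
    \<comment> \<open>Undoing the dilation gives divisors of \<open>p\<close> itself, whose root
      moduli lie in \<open>S\<close> for every \<open>t\<close>.\<close>
    define u' v' where "u' = dilate (1/t) u" and "v' = dilate (1/t) v"
    have dv: "u' dvd p" "v' dvd p" unfolding u'_def v'_def
      using dilate_dvd[OF uv(1), of "1/t"] dilate_dvd[OF uv(2), of "1/t"] tp dilate_inverse by auto
    then have S: "root_modulus u' \<in> S" "root_modulus v' \<in> S" by (auto simp: S_def)
    have "coeff u' 0 \<noteq> 0" using dv(1) p0 by (auto simp: coeff_mult_0 elim!: dvdE)
    then have nz: "u' \<noteq> 0" "coeff u' 0 \<noteq> 0" by auto
    have u: "root_modulus u = root_modulus u' / t ^ degree u"
      and v: "root_modulus v = root_modulus v' / t ^ degree v"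
      using tp by (simp_all add: u'_def v'_def root_modulus_dilate power_divide)
    have pos: "root_modulus u' \<noteq> 0" using nz by (simp add: root_modulus_def)
    have "root_modulus p / t ^ degree p * (root_modulus v' / t ^ degree v) = root_modulus u' / t ^ degree u"
      using uv(5) tp u v by (simp add: root_modulus_dilate)
    moreover have "t ^ degree p = t ^ degree u * t ^ degree v" using uv(3) by (metis power_add)
    \<comment> \<open>The net exponent \<open>degree p + degree v - degree u\<close> equals
      \<open>2 * degree v\<close>, which is positive.\<close>
    ultimately have "root_modulus p * root_modulus v' = root_modulus u' * (t ^ degree v * t ^ degree v)"
      using tp by (simp add: field_simps)
    then have "t ^ (2 * degree v) = root_modulus p * root_modulus v' / root_modulus u'"
      using pos by (simp only: mult_2 power_add) (simp add: field_simps)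
    then have "t = root (2 * degree v) (root_modulus p * root_modulus v' / root_modulus u')"
      using tp uv(4) by (metis real_root_power_cancel nat_0_less_mult_iff zero_less_numeral less_imp_le)
    then show "t \<in> T" unfolding T_def using uv(3,4) S
      by (intro image_eqI[where x="(degree v, root_modulus u', root_modulus v')"]) auto
  qed
  moreover have "finite T" unfolding T_def using fS by auto
  ultimately show ?thesis by (meson finite_subset subsetI)
qed

text \<open>Both sides have degree at most \<open>2 * degree p\<close> and agree at more points than
  that. A possible degree gap is first filled by a power of \<open>z\<close>, and then shown to be
  zero.\<close>

lemma poly_spectrum_eqI:
  fixes p q :: "complex poly"
  assumes p0: "coeff p 0 \<noteq> 0" and dq: "degree q \<le> degree p"
    and Z: "\<And>z. z \<in> Z \<Longrightarrow> cmod z = 1" "card Z > 2 * degree p"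
    and eq: "\<And>z. z \<in> Z \<Longrightarrow> cmod (poly q z) = cmod (poly p z)"
  shows "degree q = degree p" "q * conj_reflect q = p * conj_reflect p"
proof -
  let ?q = "q * monom 1 (degree p - degree q) * conj_reflect q"
  have "degree ?q \<le> degree q + (degree p - degree q) + degree q"
    by (intro order.trans[OF degree_mult_le] add_mono order.refl)
       (auto simp: conj_reflect_def degree_monom_eq intro!: order.trans[OF degree_reflect_poly_le])
  then have 1: "degree ?q < card Z" using Z dq by linarith
  have "degree (p * conj_reflect p) \<le> degree p + degree p"
    by (intro order.trans[OF degree_mult_le] add_mono order.refl)
       (auto simp: conj_reflect_def intro!: order.trans[OF degree_reflect_poly_le])
  then have 2: "degree (p * conj_reflect p) < card Z" using Z by linarith
  have eq2: "?q = p * conj_reflect p"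
  proof (rule poly_eqI_degree)
    fix z assume z: "z \<in> Z"
    have "z ^ degree p = z ^ (degree p - degree q) * z ^ degree q"
      using dq by (simp flip: power_add)
    then have "poly ?q z = z ^ degree p * (poly q z * cnj (poly q z))"
      using Z(1)[OF z] by (simp add: poly_conj_reflect poly_monom)
    also have "\<dots> = z ^ degree p * (poly p z * cnj (poly p z))"
      using eq[OF z] by (simp add: complex_norm_square[symmetric])
    also have "\<dots> = poly (p * conj_reflect p) z"
      using Z(1)[OF z] by (simp add: poly_conj_reflect)
    finally show "poly ?q z = poly (p * conj_reflect p) z" .
  qed (use 1 2 in auto)
  \<comment> \<open>A positive power of \<open>z\<close> in the padding would make the constant
    coefficient vanish.\<close>
  have "coeff (p * conj_reflect p) 0 \<noteq> 0" using p0
    by (auto simp: coeff_mult_0 coeff_0_conj_reflect)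
  then have "coeff ?q 0 \<noteq> 0" using eq2 by simp
  then have "degree p - degree q = 0" by (auto simp: coeff_mult_0 split: if_splits)
  then show "degree q = degree p" using dq by simp
  then show "q * conj_reflect q = p * conj_reflect p" using eq2 by simp
qed

subsection \<open>Null sets from dilations\<close>

text \<open>The rescaled image measure agrees with the product measure on boxes, by the scaling law
  of \<open>lborel\<close> in each coordinate; \<open>PiM_eqI\<close> then identifies the
  two.\<close>

lemma emeasure_PiM_lborel_scale:
  fixes c :: "'i \<Rightarrow> real"
  assumes I: "finite I" and c: "\<And>i. i \<in> I \<Longrightarrow> c i \<noteq> 0"
    and A: "A \<in> sets (PiM I (\<lambda>_. lborel :: 'a::euclidean_space measure))"
  defines "f \<equiv> \<lambda>x. \<lambda>i\<in>I. c i *\<^sub>R x i"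
  shows "emeasure (PiM I (\<lambda>_. lborel)) A =
    (\<Prod>i\<in>I. ennreal (\<bar>c i\<bar> ^ DIM('a))) * emeasure (PiM I (\<lambda>_. lborel)) (f -` A \<inter> space (PiM I (\<lambda>_. lborel)))"
proof -
  interpret product_sigma_finite "\<lambda>_::'i. lborel :: 'a measure" ..
  let ?M = "PiM I (\<lambda>_. lborel :: 'a measure)"
  let ?K = "\<Prod>i\<in>I. ennreal (\<bar>c i\<bar> ^ DIM('a))"
  have f[measurable]: "f \<in> measurable ?M ?M" unfolding f_def by measurable
  have "scale_measure ?K (distr ?M ?M f) = ?M"
  proof (rule PiM_eqI)
    fix X assume X: "\<And>i. i \<in> I \<Longrightarrow> X i \<in> sets (lborel :: 'a measure)"
    have *: "emeasure lborel (X i) = ennreal (\<bar>c i\<bar> ^ DIM('a)) * emeasure lborel ((\<lambda>z. c i *\<^sub>R z) -` X i)"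
      if i: "i \<in> I" for i
    proof -
      have Xi[measurable]: "X i \<in> sets borel" using X[OF i] by simp
      show ?thesis
        by (subst (1) lborel_affine[OF c[OF i], of 0]) (simp add: emeasure_density nn_integral_cmult emeasure_distr)
    qed
    have S: "(\<lambda>z. c i *\<^sub>R z) -` X i \<in> sets lborel" if i: "i \<in> I" for i
    proof -
      have Xi[measurable]: "X i \<in> sets borel" using X[OF i] by simp
      show ?thesis using measurable_sets_borel[of "\<lambda>z. c i *\<^sub>R z" borel "X i"] by simp
    qed
    have "f -` PiE I X \<inter> space ?M = PiE I (\<lambda>i. (\<lambda>z. c i *\<^sub>R z) -` X i)"
      by (auto simp: f_def space_PiM PiE_iff)
    moreover have "PiE I X \<in> sets ?M" using I X by (intro sets_PiM_I_finite) auto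
    ultimately have "emeasure (scale_measure ?K (distr ?M ?M f)) (PiE I X) =
        ?K * emeasure ?M (PiE I (\<lambda>i. (\<lambda>z. c i *\<^sub>R z) -` X i))"
      by (simp add: emeasure_distr)
    also have "\<dots> = ?K * (\<Prod>i\<in>I. emeasure lborel ((\<lambda>z. c i *\<^sub>R z) -` X i))"
      using I S by (subst emeasure_PiM) auto
    also have "\<dots> = (\<Prod>i\<in>I. emeasure lborel (X i))"
      by (simp add: * prod.distrib)
    finally show "emeasure (scale_measure ?K (distr ?M ?M f)) (PiE I X) = (\<Prod>i\<in>I. emeasure lborel (X i))" .
  qed (use I in auto)
  then have "emeasure ?M A = emeasure (scale_measure ?K (distr ?M ?M f)) A" by simp
  then show ?thesis using A by (simp add: emeasure_distr)
qed

text \<open>With weights \<open>t ^ n\<close>, the polynomials of all sections are dilated by the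
  same \<open>t\<close>, up to scalar factors.\<close>

definition weighted_dilation :: "nat \<Rightarrow> real \<Rightarrow> (nat \<Rightarrow> complex) \<Rightarrow> nat \<Rightarrow> complex" where
  "weighted_dilation N t x = (\<lambda>n\<in>{..<N}. t ^ n *\<^sub>R x n)"

text \<open>Fubini in \<open>(t, x)\<close>: some dilation \<open>t \<in> [1, 2]\<close> pulls \<open>A\<close> back to a null set,
  and dilations multiply the measure by a nonzero constant.\<close>
lemma null_if_countable_dilations:
  assumes A[measurable]: "A \<in> sets (signal_space N)"
    and cnt: "\<And>x. x \<in> space (signal_space N) \<Longrightarrow>
      countable {t. t \<in> {1..2} \<and> weighted_dilation N t x \<in> A}"
  shows "emeasure (signal_space N) A = 0"
proof -
  let ?M = "signal_space N"
  interpret product_sigma_finite "\<lambda>_::nat. lborel :: complex measure" ..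
  interpret M: sigma_finite_measure ?M unfolding signal_space_def by (rule sigma_finite) simp
  interpret P: pair_sigma_finite "lborel :: real measure" ?M ..
  let ?Q = "\<lambda>t x. \<not> (t \<in> {1..2} \<and> weighted_dilation N t x \<in> A)"
  have D[measurable]: "(\<lambda>(t, x). weighted_dilation N t x) \<in> measurable (lborel \<Otimes>\<^sub>M ?M) ?M"
    unfolding weighted_dilation_def signal_space_def by measurable
  have "AE x in ?M. AE t in lborel. ?Q t x"
  proof (rule AE_I2)
    fix x assume "x \<in> space ?M"
    then have "{t. t \<in> {1..2} \<and> weighted_dilation N t x \<in> A} \<in> null_sets lborel"
      by (intro countable_imp_null_set_lborel cnt)
    then show "AE t in lborel. ?Q t x" by (rule AE_not_in[THEN AE_mp]) auto
  qed
  moreover have "{p \<in> space (lborel \<Otimes>\<^sub>M ?M). ?Q (fst p) (snd p)} \<in> sets (lborel \<Otimes>\<^sub>M ?M)"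
    using D by measurable
  ultimately have ae: "AE t in lborel. AE x in ?M. ?Q t x"
    using P.AE_commute[of ?Q] by simp
  \<comment> \<open>The interval has positive length, so it meets the set of good \<open>t\<close>.
    It also avoids \<open>t = 0\<close>, where the scaling would degenerate.\<close>
  have "\<exists>t\<in>{1..2}. AE x in ?M. ?Q t x"
  proof (rule ccontr)
    assume "\<not> ?thesis"
    with ae have "AE t in lborel. t \<notin> {1..2::real}" by (auto elim: AE_mp)
    then have "{1..2::real} \<in> null_sets lborel" by (subst AE_iff_null_sets) auto
    then show False by (simp add: null_sets_def)
  qed
  then obtain t where t: "t \<in> {1..2}" "AE x in ?M. weighted_dilation N t x \<notin> A" by auto
  have [measurable]: "weighted_dilation N t \<in> measurable ?M ?M"
    unfolding weighted_dilation_def signal_space_def by measurable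
  have "weighted_dilation N t -` A \<inter> space ?M \<in> sets ?M" by measurable
  then have "emeasure ?M (weighted_dilation N t -` A \<inter> space ?M) = 0"
    using t(2) by (subst AE_iff_measurable[symmetric, where P="\<lambda>x. weighted_dilation N t x \<notin> A"]) auto
  then show ?thesis
    using emeasure_PiM_lborel_scale[of "{..<N}" "\<lambda>n. t ^ n" A] t(1) A
    by (simp add: signal_space_def weighted_dilation_def[abs_def])
qed

text \<open>Points of \<open>signal_space N\<close> are \<open>undefined\<close> from
  \<open>N\<close> on. Extending by zero places them in boxes that are compact in the product
  topology on all functions.\<close>

definition zero_extend :: "nat \<Rightarrow> (nat \<Rightarrow> complex) \<Rightarrow> nat \<Rightarrow> complex" where
  "zero_extend N x = (\<lambda>n. if n < N then x n else 0)"

text \<open>Projecting along \<open>y\<close> does not preserve Borel sets in general; here the set is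
  \<open>\<sigma>\<close>-compact, and projections of compact sets are compact.\<close>
lemma projection_measurable:
  fixes g :: "(nat \<Rightarrow> complex) \<times> (nat \<Rightarrow> complex) \<Rightarrow> real"
  assumes C: "closed C" and g: "continuous_on UNIV g"
  shows "{x \<in> space (signal_space N). \<exists>y. (zero_extend N x, zero_extend N y) \<in> C \<and>
      g (zero_extend N x, zero_extend N y) > 0} \<in> sets (signal_space N)" (is "?B \<in> _")
proof -
  let ?M = "signal_space N"
  define K :: "nat \<Rightarrow> (nat \<Rightarrow> complex) set" where
    "K k = PiE UNIV (\<lambda>n. if n < N then cball 0 (real k) else {0})" for k
  \<comment> \<open>The open condition \<open>g p > 0\<close> is exhausted by closed ones, with
    bounds \<open>1 / real (Suc k)\<close>, while the boxes grow with \<open>k\<close>.\<close>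
  define S where "S k = fst ` ((K k \<times> K k) \<inter> (C \<inter> {p. 1 / real (Suc k) \<le> g p}))" for k
  have "compact (K k)" for k
    unfolding K_def compactin_euclidean_iff[symmetric] euclidean_product_topology[symmetric]
    by (subst compactin_PiE) (auto simp: compactin_euclidean_iff)
  then have "compact (S k)" for k
    unfolding S_def using g C
    by (intro compact_continuous_image continuous_intros compact_Int_closed compact_Times closed_Int
        closed_Collect_le) auto
  then have Sb[measurable]: "S k \<in> sets borel" for k by (intro borel_closed compact_imp_closed)
  have [measurable]: "zero_extend N \<in> borel_measurable ?M"
  proof (rule measurable_coordinatewise_then_product)
    fix n show "(\<lambda>x. zero_extend N x n) \<in> borel_measurable ?M"
      unfolding zero_extend_def signal_space_def by (cases "n < N") auto
  qed
  have "?B = (\<Union>k. zero_extend N -` S k \<inter> space ?M)"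
  proof (intro equalityI subsetI)
    fix x assume "x \<in> ?B"
    then obtain y where x: "x \<in> space ?M" and y: "(zero_extend N x, zero_extend N y) \<in> C"
      "g (zero_extend N x, zero_extend N y) > 0" by auto
    obtain k1 where k1: "1 / real (Suc k1) < g (zero_extend N x, zero_extend N y)"
      using y(2) nat_approx_posE by blast
    obtain k2 where k2: "(\<Sum>n<N. cmod (x n) + cmod (y n)) < real k2" using reals_Archimedean2 by blast
    define k where "k = max k1 k2"
    have "1 / real (Suc k) \<le> 1 / real (Suc k1)" by (simp add: k_def frac_le)
    then have 1: "1 / real (Suc k) \<le> g (zero_extend N x, zero_extend N y)" using k1 by linarith
    have "cmod (x n) + cmod (y n) \<le> real k" if "n < N" for n
    proof -
      have "cmod (x n) + cmod (y n) \<le> (\<Sum>n<N. cmod (x n) + cmod (y n))"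
        using that by (intro member_le_sum) auto
      then show ?thesis using k2 unfolding k_def by linarith
    qed
    then have "cmod (x n) \<le> real k \<and> cmod (y n) \<le> real k" if "n < N" for n
      using that by (smt (verit) norm_ge_zero)
    then have "zero_extend N x \<in> K k" "zero_extend N y \<in> K k"
      by (auto simp: K_def zero_extend_def)
    then have "zero_extend N x \<in> S k" unfolding S_def using 1 y by force
    then show "x \<in> (\<Union>k. zero_extend N -` S k \<inter> space ?M)" using x by auto
  next
    fix x assume "x \<in> (\<Union>k. zero_extend N -` S k \<inter> space ?M)"
    then obtain k y where x: "x \<in> space ?M" and y: "y \<in> K k" "(zero_extend N x, y) \<in> C"
      "1 / real (Suc k) \<le> g (zero_extend N x, y)" by (auto simp: S_def)
    have "y n \<in> (if n < N then cball 0 (real k) else {0})" for n using y(1) by (simp add: K_def PiE_iff)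
    then have "y n = 0" if "\<not> n < N" for n using that by (metis singletonD)
    then have "zero_extend N y = y" by (simp add: zero_extend_def fun_eq_iff)
    moreover have "g (zero_extend N x, y) > 0" using y(3) by (smt (verit) zero_less_divide_iff of_nat_0_less_iff zero_less_Suc)
    ultimately show "x \<in> ?B" using x y by (auto intro!: exI[of _ y])
  qed
  also have "\<dots> \<in> sets ?M" by measurable
  finally show ?thesis .
qed

subsection \<open>Short-time sections\<close>

text \<open>Indices are shifted by \<open>a\<close> so that the first sample of the section becomes
  the constant coefficient; the dropped power of \<open>z\<close> has modulus 1 on the unit
  circle.\<close>

definition section_poly :: "(nat \<Rightarrow> complex) \<Rightarrow> nat \<Rightarrow> nat \<Rightarrow> (nat \<Rightarrow> complex) \<Rightarrow> nat \<Rightarrow> nat \<Rightarrow> nat \<Rightarrow> complex poly" where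
  "section_poly w W L x r a d = (\<Sum>i\<le>d. monom (x (a + i) * win_ext w W (int r * int L - int (a + i))) i)"

lemma coeff_section_poly:
  "coeff (section_poly w W L x r a d) i =
    (if i \<le> d then x (a + i) * win_ext w W (int r * int L - int (a + i)) else 0)"
  by (simp add: section_poly_def coeff_sum coeff_monom)

lemma degree_section_poly_le: "degree (section_poly w W L x r a d) \<le> d"
  by (intro degree_le) (simp add: coeff_section_poly)

definition dft_node :: "nat \<Rightarrow> int \<Rightarrow> complex" where
  "dft_node N m = exp (- (\<i> * 2 * pi * of_int m / of_nat N))"

lemma norm_dft_node [simp]: "cmod (dft_node N m) = 1"
  by (simp add: dft_node_def)

lemma inj_on_dft_node: "inj_on (\<lambda>m. dft_node N (int m)) {1..N}"
proof (rule inj_onI)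
  fix j k assume jk: "j \<in> {1..N}" "k \<in> {1..N}" "dft_node N (int j) = dft_node N (int k)"
  then have "inverse (dft_node N (int j)) = inverse (dft_node N (int k))" by simp
  then have "exp (2 * of_real pi * \<i> * of_nat j / of_nat N) = exp (2 * of_real pi * \<i> * of_nat k / of_nat N)"
    by (simp add: dft_node_def exp_minus mult_ac)
  then have "j mod N = k mod N" using jk by (subst (asm) complex_root_unity_eq) (auto simp: cong_def)
  \<comment> \<open>In \<open>{1..N}\<close> the residue \<open>0\<close> is represented by
    \<open>N\<close>.\<close>
  then show "j = k" using jk by (cases "j = N"; cases "k = N") auto
qed

text \<open>The measurements of a section are thus squared moduli of its polynomial at roots of
  unity.\<close>

lemma stft_eq_poly_section:
  assumes "a + d < N"
    and out: "\<And>n. n < N \<Longrightarrow> n \<notin> {a..a+d} \<Longrightarrow> win_ext w W (int r * int L - int n) = 0"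
  shows "stft N w W L x m r = dft_node N m ^ a * poly (section_poly w W L x r a d) (dft_node N m)"
proof -
  have e: "exp (- (\<i> * 2 * pi * of_int m * of_nat n / of_nat N)) = dft_node N m ^ n" for n :: nat
    unfolding dft_node_def exp_of_nat_mult[symmetric] by (simp add: mult_ac)
  have "stft N w W L x m r = (\<Sum>n\<in>{a..a+d}. x n * win_ext w W (int r * int L - int n) * dft_node N m ^ n)"
    unfolding stft_def e using assms by (intro sum.mono_neutral_right) auto
  also have "\<dots> = (\<Sum>i\<le>d. x (a + i) * win_ext w W (int r * int L - int (a + i)) * dft_node N m ^ (a + i))"
    by (rule sum.reindex_bij_witness[of _ "\<lambda>i. a + i" "\<lambda>n. n - a"]) auto
  also have "\<dots> = dft_node N m ^ a * poly (section_poly w W L x r a d) (dft_node N m)"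
    by (simp add: section_poly_def poly_sum poly_monom sum_distrib_left power_add mult_ac)
  finally show ?thesis .
qed

text \<open>Truncated subtraction here, and the minimum in \<open>sec_hi\<close>, clip the reversed
  window at the two ends of the signal.\<close>

definition sec_lo :: "nat \<Rightarrow> nat \<Rightarrow> nat \<Rightarrow> nat" where
  "sec_lo W L r = r * L + 1 - W"

definition sec_hi :: "nat \<Rightarrow> nat \<Rightarrow> nat \<Rightarrow> nat" where
  "sec_hi N L r = min (r * L) (N - 1)"

definition full_section_poly :: "nat \<Rightarrow> (nat \<Rightarrow> complex) \<Rightarrow> nat \<Rightarrow> nat \<Rightarrow> (nat \<Rightarrow> complex) \<Rightarrow> nat \<Rightarrow> complex poly" where
  "full_section_poly N w W L x r = section_poly w W L x r (sec_lo W L r) (sec_hi N L r - sec_lo W L r)"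

context
  fixes N W L M :: nat and w :: "nat \<Rightarrow> complex"
  assumes N: "0 < N" and L0: "0 < L" and w: "\<forall>n<W. w n \<noteq> 0" and LW: "L < W"
    and WM: "2 * W \<le> M" and MN: "M \<le> N"
begin

lemma win_ext_nonzero_iff:
  assumes "n < N"
  shows "win_ext w W (int r * int L - int n) \<noteq> 0 \<longleftrightarrow> n \<in> {sec_lo W L r..sec_hi N L r}"
proof -
  have "0 \<le> int r * int L - int n \<and> int r * int L - int n < int W \<longleftrightarrow> n \<in> {sec_lo W L r..sec_hi N L r}"
    using assms of_nat_mult[of r L, where 'a=int] unfolding sec_lo_def sec_hi_def atLeastAtMost_iff
    by linarith
  moreover have "w (nat k) \<noteq> 0" if "0 \<le> k" "k < int W" for k using w that by auto
  ultimately show ?thesis by (auto simp: win_ext_def)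
qed

lemma
  assumes x: "\<And>n. n < N \<Longrightarrow> x n \<noteq> 0" and ne: "sec_lo W L r \<le> sec_hi N L r"
  shows coeff_0_full_section_poly: "coeff (full_section_poly N w W L x r) 0 \<noteq> 0"
    and degree_full_section_poly:
      "degree (full_section_poly N w W L x r) = sec_hi N L r - sec_lo W L r"
proof -
  have hi: "sec_hi N L r < N" using N by (auto simp: sec_hi_def)
  then show "coeff (full_section_poly N w W L x r) 0 \<noteq> 0"
    unfolding full_section_poly_def coeff_section_poly
    using x[of "sec_lo W L r"] ne win_ext_nonzero_iff[of "sec_lo W L r" r] by auto
  have "coeff (full_section_poly N w W L x r) (sec_hi N L r - sec_lo W L r) \<noteq> 0"
    unfolding full_section_poly_def coeff_section_poly
    using hi x[of "sec_hi N L r"] ne win_ext_nonzero_iff[of "sec_hi N L r" r] by auto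
  then show "degree (full_section_poly N w W L x r) = sec_hi N L r - sec_lo W L r"
    using le_degree degree_section_poly_le unfolding full_section_poly_def by (metis le_antisym)
qed

text \<open>The measurements fix the spectrum of the section polynomial; retrievability and one
  known modulus then fix the polynomial up to a scalar, and dividing by the nonzero window values
  recovers the samples.\<close>

lemma section_determined:
  assumes x: "\<And>n. n < N \<Longrightarrow> x n \<noteq> 0" and ne: "sec_lo W L r \<le> sec_hi N L r"
    and pr: "phase_retrievable (full_section_poly N w W L x r)"
    and meas: "\<And>m. 1 \<le> m \<Longrightarrow> m \<le> M \<Longrightarrow> stft_mag N w W L y (int m) r = stft_mag N w W L x (int m) r"
    and lo: "cmod (y (sec_lo W L r)) = cmod (x (sec_lo W L r))"
  obtains c where "\<And>n. n \<in> {sec_lo W L r..sec_hi N L r} \<Longrightarrow> y n = c * x n"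
proof -
  let ?a = "sec_lo W L r" let ?d = "sec_hi N L r - ?a"
  let ?p = "full_section_poly N w W L x r" and ?q = "full_section_poly N w W L y r"
  have hi: "sec_hi N L r < N" using N by (auto simp: sec_hi_def)
  have deg: "degree ?p = ?d" using degree_full_section_poly[OF x ne] .
  have p0: "coeff ?p 0 \<noteq> 0" using coeff_0_full_section_poly[OF x ne] .
  let ?Z = "(\<lambda>m. dft_node N (int m)) ` {1..M}"
  have st: "stft N w W L z m r = dft_node N m ^ ?a * poly (full_section_poly N w W L z r) (dft_node N m)" for z m
    unfolding full_section_poly_def using hi ne win_ext_nonzero_iff by (intro stft_eq_poly_section) auto
  \<comment> \<open>The degree is at most \<open>W - 1\<close>, so the \<open>M \<ge> 2 * W\<close>
    distinct nodes exceed twice the degree.\<close>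
  have "card ?Z = M" using MN inj_on_subset[OF inj_on_dft_node[of N], of "{1..M}"] by (simp add: card_image)
  moreover have "?d < W" using LW by (auto simp: sec_lo_def sec_hi_def)
  ultimately have Z: "card ?Z > 2 * degree ?p" using deg WM by linarith
  have eq: "cmod (poly ?q z) = cmod (poly ?p z)" if z: "z \<in> ?Z" for z
  proof -
    obtain m where m: "1 \<le> m" "m \<le> M" "z = dft_node N (int m)" using z by auto
    have "(cmod (poly ?q z))\<^sup>2 = (cmod (poly ?p z))\<^sup>2"
      using meas[OF m(1,2)] unfolding stft_mag_def st m(3) by (simp add: norm_mult norm_power)
    then show ?thesis by simp
  qed
  have Z1: "cmod z = 1" if "z \<in> ?Z" for z using that by auto
  have dq: "degree ?q \<le> degree ?p" unfolding deg using degree_section_poly_le by (simp add: full_section_poly_def)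
  have "degree ?q = degree ?p" "?q * conj_reflect ?q = ?p * conj_reflect ?p"
    using poly_spectrum_eqI[OF p0 dq _ Z eq] by (blast intro: Z1)+
  moreover have "cmod (coeff ?q 0) = cmod (coeff ?p 0)"
    using lo by (simp add: full_section_poly_def coeff_section_poly norm_mult)
  ultimately obtain c where c: "?q = smult c ?p" using pr unfolding phase_retrievable_def by blast
  have "y n = c * x n" if n: "n \<in> {?a..sec_hi N L r}" for n
  proof -
    have "coeff ?q (n - ?a) = c * coeff ?p (n - ?a)" using c by simp
    moreover have "win_ext w W (int r * int L - int n) \<noteq> 0" using n hi win_ext_nonzero_iff by auto
    moreover have "?a + (n - ?a) = n" "n - ?a \<le> ?d" using n by auto
    ultimately show ?thesis by (simp add: full_section_poly_def coeff_section_poly)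
  qed
  then show ?thesis using that by blast
qed

section \<open>Propagating the phase from sample 0\<close>

lemma stft_section_0: "stft N w W L x m 0 = x 0 * w 0"
proof -
  \<comment> \<open>At \<open>r = 0\<close> the window is evaluated at \<open>-n\<close>, so only
    \<open>n = 0\<close> survives.\<close>
  have "stft N w W L x m 0 = dft_node N m ^ 0 * poly (section_poly w W L x 0 0 0) (dft_node N m)"
    using N by (intro stft_eq_poly_section) (auto simp: win_ext_def)
  then show ?thesis using LW by (simp add: section_poly_def win_ext_def poly_monom)
qed

lemma norm_eq_at_0:
  assumes "\<forall>m r. 1 \<le> m \<and> m \<le> M \<and> r < num_sections N W L \<longrightarrow>
           stft_mag N w W L y (int m) r = stft_mag N w W L x (int m) r"
  shows "cmod (y 0) = cmod (x 0)"
proof -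
  have "0 < real (N + W - 1) / real L" using N LW L0 by simp
  then have "0 < num_sections N W L" unfolding num_sections_def by linarith
  moreover have "w 0 \<noteq> 0" using w LW by auto
  ultimately have "(cmod (y 0))\<^sup>2 = (cmod (x 0))\<^sup>2"
    using spec[OF spec[OF assms, of 1], of 0] WM LW
    by (simp add: stft_mag_def stft_section_0 norm_mult power_mult_distrib)
  then show ?thesis by simp
qed

text \<open>As long as section \<open>r\<close> stops short of the last sample, the next section is
  still measured.\<close>

lemma num_sections_gt:
  assumes "r * L < N - 1" shows "Suc r < num_sections N W L"
proof -
  have "Suc r * L < N + W - 1" using assms LW by simp
  then have "real (Suc r) * real L < real (N + W - 1)" by (metis of_nat_less_iff of_nat_mult)
  then have "real (Suc r) < real (N + W - 1) / real L" using L0 by (simp add: pos_less_divide_eq)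
  then have "int (Suc r) < \<lceil>real (N + W - 1) / real L\<rceil>" unfolding less_ceiling_iff of_int_of_nat_eq .
  then show ?thesis unfolding num_sections_def by linarith
qed

text \<open>Induction over the sections: because \<open>L < W\<close>, section \<open>Suc r\<close>
  starts at or before the last sample \<open>r * L\<close> of section \<open>r\<close>. This common
  sample supplies the modulus needed for retrieval and fixes the phase.\<close>

lemma sections_glue:
  assumes x: "\<And>n. n < N \<Longrightarrow> x n \<noteq> 0"
    and pr: "\<And>r. r < num_sections N W L \<Longrightarrow> sec_lo W L r \<le> sec_hi N L r \<Longrightarrow>
      phase_retrievable (full_section_poly N w W L x r)"
    and meas: "\<And>m r. 1 \<le> m \<Longrightarrow> m \<le> M \<Longrightarrow> r < num_sections N W L \<Longrightarrow>
      stft_mag N w W L y (int m) r = stft_mag N w W L x (int m) r"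
  obtains c where "cmod c = 1" "\<And>n. n < N \<Longrightarrow> y n = c * x n"
proof -
  define c where "c = y 0 / x 0"
  have "cmod (y 0) = cmod (x 0)" using meas by (intro norm_eq_at_0) auto
  then have c1: "cmod c = 1" using x[OF N] by (simp add: c_def norm_divide)
  have IH: "\<forall>n\<le>sec_hi N L r. y n = c * x n" for r
  proof (induction r)
    case 0
    then show ?case using x[OF N] by (simp add: sec_hi_def c_def)
  next
    case (Suc r)
    show ?case
    proof (cases "r * L < N - 1")
      case False
      then have "sec_hi N L (Suc r) = sec_hi N L r" by (auto simp: sec_hi_def)
      then show ?thesis using Suc by simp
    next
      case True
      let ?a = "sec_lo W L (Suc r)"
      have hr: "sec_hi N L r = r * L" using True by (simp add: sec_hi_def)
      have a: "?a \<le> r * L" using LW by (simp add: sec_lo_def)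
      have ne: "?a \<le> sec_hi N L (Suc r)" using a True by (simp add: sec_hi_def)
      have ya: "y ?a = c * x ?a" using Suc a hr by simp
      then have lo: "cmod (y ?a) = cmod (x ?a)" using c1 by (simp add: norm_mult)
      have R': "Suc r < num_sections N W L" using num_sections_gt[OF True] .
      obtain c' where c': "\<And>n. n \<in> {?a..sec_hi N L (Suc r)} \<Longrightarrow> y n = c' * x n"
        using section_determined[OF x ne pr[OF R' ne] meas lo] R' by metis
      \<comment> \<open>The nonzero common sample forces the new scalar to equal
        \<open>c\<close>.\<close>
      have "x ?a \<noteq> 0" using x a True by simp
      then have "c' = c" using c'[of ?a] ya ne by simp
      show ?thesis
      proof (intro allI impI)
        fix n assume n: "n \<le> sec_hi N L (Suc r)"
        show "y n = c * x n"
        proof (cases "n \<le> r * L")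
          case True
          then show ?thesis using Suc hr by simp
        next
          case False
          then show ?thesis using n a c'[of n] \<open>c' = c\<close> by simp
        qed
      qed
    qed
  qed
  have "y n = c * x n" if n: "n < N" for n
  proof -
    \<comment> \<open>As \<open>L \<ge> 1\<close>, the claim for section \<open>n\<close> already
      covers sample \<open>n\<close>.\<close>
    have "n * 1 \<le> n * L" using L0 by (intro mult_le_mono) auto
    then show ?thesis using IH[of n] n by (auto simp: sec_hi_def)
  qed
  then show ?thesis using that c1 by blast
qed

section \<open>Ambiguous signals form a null set\<close>

lemma full_section_poly_weighted_dilation:
  assumes "sec_lo W L r \<le> sec_hi N L r"
  shows "full_section_poly N w W L (weighted_dilation N t x) r =
    smult (of_real (t ^ sec_lo W L r)) (dilate t (full_section_poly N w W L x r))"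
proof (rule poly_eqI)
  fix i
  have "sec_hi N L r < N" using N by (auto simp: sec_hi_def)
  then show "coeff (full_section_poly N w W L (weighted_dilation N t x) r) i =
    coeff (smult (of_real (t ^ sec_lo W L r)) (dilate t (full_section_poly N w W L x r))) i"
    using assms by (cases "i \<le> sec_hi N L r - sec_lo W L r")
      (auto simp: full_section_poly_def coeff_section_poly coeff_dilate weighted_dilation_def
        power_add scaleR_conv_of_real)
qed

lemma stft_zero_extend: "stft N w W L (zero_extend N x) m r = stft N w W L x m r"
  unfolding stft_def by (intro sum.cong) (auto simp: zero_extend_def)

lemma zero_extend_nth: "n < N \<Longrightarrow> zero_extend N x n = x n"
  by (simp add: zero_extend_def)

text \<open>Failure of proportionality is stated by cross-multiplication, which is continuous in
  \<open>x\<close> and \<open>y\<close> and avoids division.\<close>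

definition ambiguous_signals :: "(nat \<Rightarrow> complex) set" where
  "ambiguous_signals = {x \<in> space (signal_space N). (\<forall>n<N. x n \<noteq> 0) \<and>
    (\<exists>y. (\<forall>m r. 1 \<le> m \<and> m \<le> M \<and> r < num_sections N W L \<longrightarrow>
           stft_mag N w W L y (int m) r = stft_mag N w W L x (int m) r) \<and>
         (\<exists>n<N. y n * x 0 \<noteq> y 0 * x n))}"

lemma sets_ambiguous_signals: "ambiguous_signals \<in> sets (signal_space N)"
proof -
  define C where "C = {p. \<forall>m r. 1 \<le> m \<and> m \<le> M \<and> r < num_sections N W L \<longrightarrow>
           stft_mag N w W L (snd p) (int m) r = stft_mag N w W L (fst p) (int m) r}"
  \<comment> \<open>A single continuous function that is positive exactly when some cross-multiplied
    equation fails.\<close>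
  define g :: "(nat \<Rightarrow> complex) \<times> (nat \<Rightarrow> complex) \<Rightarrow> real"
    where "g p = (\<Sum>n<N. cmod (snd p n * fst p 0 - snd p 0 * fst p n))" for p
  have c1: "continuous_on UNIV (\<lambda>p::(nat \<Rightarrow> complex) \<times> (nat \<Rightarrow> complex). fst p n)"
    and c2: "continuous_on UNIV (\<lambda>p::(nat \<Rightarrow> complex) \<times> (nat \<Rightarrow> complex). snd p n)" for n
    by (rule continuous_on_product_then_coordinatewise, intro continuous_intros)+
  have "continuous_on UNIV g" unfolding g_def by (intro continuous_intros c1 c2)
  moreover have "closed C"
    unfolding C_def stft_mag_def stft_def
    by (intro closed_Collect_all closed_Collect_imp closed_Collect_eq continuous_intros c1 c2) auto
  ultimately have "{x \<in> space (signal_space N). \<exists>y. (zero_extend N x, zero_extend N y) \<in> C \<and>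
      g (zero_extend N x, zero_extend N y) > 0} \<in> sets (signal_space N)" (is "?B \<in> _")
    by (intro projection_measurable)
  moreover have "g (zero_extend N x, zero_extend N y) > 0 \<longleftrightarrow> (\<exists>n<N. y n * x 0 \<noteq> y 0 * x n)" for x y
  proof -
    have "g (zero_extend N x, zero_extend N y) \<noteq> 0 \<longleftrightarrow> (\<exists>n<N. y n * x 0 \<noteq> y 0 * x n)"
      using N by (auto simp: g_def sum_nonneg_eq_0_iff zero_extend_nth)
    moreover have "g (zero_extend N x, zero_extend N y) \<ge> 0" by (simp add: g_def sum_nonneg)
    ultimately show ?thesis by (simp add: less_le)
  qed
  ultimately have "{x \<in> space (signal_space N). \<exists>y. (zero_extend N x, zero_extend N y) \<in> C \<and>
      (\<exists>n<N. y n * x 0 \<noteq> y 0 * x n)} \<in> sets (signal_space N)" (is "?B \<in> _") by simp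
  moreover have "{x \<in> space (signal_space N). \<forall>n\<in>{..<N}. x n \<noteq> 0} \<in> sets (signal_space N)" (is "?D \<in> _")
    unfolding signal_space_def by measurable
  ultimately have "?D \<inter> ?B \<in> sets (signal_space N)" by blast
  also have "?D \<inter> ?B = ambiguous_signals"
    by (auto simp: ambiguous_signals_def C_def stft_mag_def stft_zero_extend)
  finally show ?thesis .
qed

text \<open>If all section polynomials of the dilated signal are retrievable, gluing leaves no
  ambiguity. So an ambiguous \<open>t\<close> is bad for one of finitely many sections, each with
  finitely many bad dilations.\<close>

lemma finite_ambiguous_dilations:
  "finite {t. t \<in> {1..2} \<and> weighted_dilation N t x \<in> ambiguous_signals}"
proof (cases "\<forall>n<N. x n \<noteq> 0")
  case False
  \<comment> \<open>A zero sample stays zero under every dilation.\<close>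
  then have "weighted_dilation N t x \<notin> ambiguous_signals" for t
    by (auto simp: ambiguous_signals_def weighted_dilation_def)
  then show ?thesis by simp
next
  case True
  define Rs where "Rs = {r. r < num_sections N W L \<and> sec_lo W L r \<le> sec_hi N L r}"
  have "{t. t \<in> {1..2} \<and> weighted_dilation N t x \<in> ambiguous_signals} \<subseteq>
    (\<Union>r\<in>Rs. {t. t > 0 \<and> \<not> phase_retrievable (dilate t (full_section_poly N w W L x r))})"
  proof (rule ccontr)
    assume "\<not> ?thesis"
    then obtain t where t: "t \<in> {1..2}" and bad: "weighted_dilation N t x \<in> ambiguous_signals"
      and good: "\<And>r. r \<in> Rs \<Longrightarrow> phase_retrievable (dilate t (full_section_poly N w W L x r))"
      by fastforce
    let ?x = "weighted_dilation N t x"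
    from bad obtain y n where x: "\<forall>n<N. ?x n \<noteq> 0"
      and y: "\<forall>m r. 1 \<le> m \<and> m \<le> M \<and> r < num_sections N W L \<longrightarrow>
           stft_mag N w W L y (int m) r = stft_mag N w W L ?x (int m) r"
      and n: "n < N" "y n * ?x 0 \<noteq> y 0 * ?x n" by (auto simp: ambiguous_signals_def)
    have "phase_retrievable (full_section_poly N w W L ?x r)"
      if "r < num_sections N W L" "sec_lo W L r \<le> sec_hi N L r" for r
      unfolding full_section_poly_weighted_dilation[OF that(2)]
      using that t by (intro phase_retrievable_smult good) (auto simp: Rs_def)
    note retrievable = this
    obtain c where "\<And>n. n < N \<Longrightarrow> y n = c * ?x n"
      by (rule sections_glue[of ?x y]) (use retrievable x y in auto)
    then show False using n N by simp
  qed
  moreover have "finite (\<Union>r\<in>Rs. {t. t > 0 \<and> \<not> phase_retrievable (dilate t (full_section_poly N w W L x r))})"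
    using True unfolding Rs_def
    by (intro finite_UN_I finite_bad_dilations coeff_0_full_section_poly) auto
  ultimately show ?thesis by (rule finite_subset)
qed

lemma null_ambiguous_signals: "emeasure (signal_space N) ambiguous_signals = 0"
  by (intro null_if_countable_dilations sets_ambiguous_signals countable_finite finite_ambiguous_dilations)

end

theorem theorem1:
  fixes N W L M :: nat and w :: "nat \<Rightarrow> complex"
  assumes "0 < N" "0 < W" "0 < L" "0 < M"
    and "\<forall>n<W. w n \<noteq> 0"
    and "L < W" "2 * W \<le> N"
    and "2 * W \<le> M" "M \<le> N"
  shows "AE x in signal_space N.
           (\<forall>n<N. x n \<noteq> 0) \<longrightarrow>
           (\<forall>y :: nat \<Rightarrow> complex.
              (\<forall>m r. 1 \<le> m \<and> m \<le> M \<and> r < num_sections N W L \<longrightarrow>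
                 stft_mag N w W L y (int m) r = stft_mag N w W L x (int m) r)
              \<longrightarrow> (\<exists>\<phi>::real. \<forall>n<N. y n = exp (\<i> * of_real \<phi>) * x n))"
proof -
  note ctx = assms(1,3,5,6,8,9)
  let ?A = "ambiguous_signals N W L M w"
  have "?A \<in> null_sets (signal_space N)"
    using null_ambiguous_signals[OF ctx] sets_ambiguous_signals[OF ctx] by (simp add: null_sets_def)
  then have "AE x in signal_space N. x \<notin> ?A" by (rule AE_not_in)
  then show ?thesis
    using AE_space
  proof eventually_elim
    case (elim x)
    show ?case
    proof (intro impI allI)
      fix y
      assume x: "\<forall>n<N. x n \<noteq> 0"
        and y: "\<forall>m r. 1 \<le> m \<and> m \<le> M \<and> r < num_sections N W L \<longrightarrow>
          stft_mag N w W L y (int m) r = stft_mag N w W L x (int m) r"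
      have proportional: "y n * x 0 = y 0 * x n" if "n < N" for n
        using elim x y that unfolding ambiguous_signals_def[OF ctx] by blast
      have x0: "x 0 \<noteq> 0" using x assms(1) by simp
      have n1: "cmod (y 0 / x 0) = 1" using norm_eq_at_0[OF ctx y] x0 by (simp add: norm_divide)
      then have "y 0 / x 0 \<noteq> 0" by (metis norm_zero zero_neq_one)
      from Arg_eq[OF this] have "y 0 / x 0 = exp (\<i> * of_real (Arg (y 0 / x 0)))"
        unfolding n1 by (simp only: of_real_1 mult_1)
      moreover have "y n = y 0 / x 0 * x n" if "n < N" for n
        using proportional[OF that] x0 by (simp add: field_simps)
      ultimately have "\<forall>n<N. y n = exp (\<i> * of_real (Arg (y 0 / x 0))) * x n" by metis
      then show "\<exists>\<phi>::real. \<forall>n<N. y n = exp (\<i> * of_real \<phi>) * x n" by blast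
    qed
  qed
qed

end
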